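(* There is a $2$-approximation algorithm for the MaxMin-balancing problem with running time $O(|I|^2)$, where $|I|$ denotes the overall length of the input instance $I$ in binary encoding. That is, the algorithm computes, for every instance $I$ of the MaxMin-balancing problem, an assignment of the jobs to machines whose minimum machine load is at least half of the maximum possible minimum machine load.
   Context: MaxMin-allocation problem: given a finite set $J$ of jobs, a finite set $M$ of machines and processing times $p_{i,j}\in\mathbb{N}^+\cup\{\infty\}$ for $i\in M$, $j\in J$, where job $j$ can be assigned to machine $i$ if and only if $p_{i,j}<\infty$ (each job can be assigned to at least one machine). Each job is assigned to one machine to which it can be assigned; the load $\ell_i$ of machine $i$ is the sum of $p_{i,j}$ over the jobs $j$ assigned to $i$; the objective is to maximize $\min_{i\in M}\ell_i$. MaxMin-balancing problem: the special case of MaxMin-allocation in which every job can be assigned to at most two machines (with possibly different processing times on them). *)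

theory Defs
  imports
    Complex_Main
    "HOL-Library.Extended_Nat"
    "HOL-Library.FuncSet"
    "HOL-Library.Landau_Symbols"
    "HOL-Library.Log_Nat"
begin

section \<open>MaxMin-allocation and MaxMin-balancing\<close>

text \<open>
  An instance has machines \<open>0, \<dots>, m - 1\<close>, jobs \<open>0, \<dots>, n - 1\<close> and processing times \<open>p i j\<close> for
  machine \<open>i\<close> and job \<open>j\<close>, with value \<open>\<infinity>\<close> if \<open>j\<close> cannot be assigned to \<open>i\<close>.
\<close>

definition eligible :: "nat \<Rightarrow> (nat \<Rightarrow> nat \<Rightarrow> enat) \<Rightarrow> nat \<Rightarrow> nat set" where
  "eligible m p j = {i. i < m \<and> p i j < \<infinity>}"

definition maxmin_allocation :: "nat \<Rightarrow> nat \<Rightarrow> (nat \<Rightarrow> nat \<Rightarrow> enat) \<Rightarrow> bool" where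
  "maxmin_allocation m n p \<longleftrightarrow>
     (\<forall>i<m. \<forall>j<n. 0 < p i j) \<and> (\<forall>j<n. eligible m p j \<noteq> {})"

definition maxmin_balancing :: "nat \<Rightarrow> nat \<Rightarrow> (nat \<Rightarrow> nat \<Rightarrow> enat) \<Rightarrow> bool" where
  "maxmin_balancing m n p \<longleftrightarrow>
     maxmin_allocation m n p \<and> (\<forall>j<n. card (eligible m p j) \<le> 2)"

definition assignments :: "nat \<Rightarrow> nat \<Rightarrow> (nat \<Rightarrow> nat \<Rightarrow> enat) \<Rightarrow> (nat \<Rightarrow> nat) set" where
  "assignments m n p = (\<Pi>\<^sub>E j\<in>{..<n}. eligible m p j)"

definition load :: "nat \<Rightarrow> (nat \<Rightarrow> nat \<Rightarrow> enat) \<Rightarrow> (nat \<Rightarrow> nat) \<Rightarrow> nat \<Rightarrow> enat" where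
  "load n p \<sigma> i = (\<Sum>j | j < n \<and> \<sigma> j = i. p i j)"

text \<open>
  For \<open>m = 0\<close> the value below is the unspecified \<open>Min {}\<close>. There are then no jobs and exactly one
  assignment, so this degenerate case carries no content.
\<close>

definition min_load :: "nat \<Rightarrow> nat \<Rightarrow> (nat \<Rightarrow> nat \<Rightarrow> enat) \<Rightarrow> (nat \<Rightarrow> nat) \<Rightarrow> enat" where
  "min_load m n p \<sigma> = Min (load n p \<sigma> ` {..<m})"

definition opt :: "nat \<Rightarrow> nat \<Rightarrow> (nat \<Rightarrow> nat \<Rightarrow> enat) \<Rightarrow> enat" where
  "opt m n p = Max (min_load m n p ` assignments m n p)"

lemma finite_assignments: "finite (assignments m n p)"
  unfolding assignments_def eligible_def by (intro finite_PiE) auto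

lemma assignments_nonempty: "maxmin_allocation m n p \<Longrightarrow> assignments m n p \<noteq> {}"
  unfolding assignments_def maxmin_allocation_def by (auto simp: PiE_eq_empty_iff)


section \<open>Input encoding\<close>

text \<open>
  An instance is written as the sequence of natural numbers \<open>m\<close>, \<open>n\<close> followed by one block per job.
  The block of job \<open>j\<close> is \<open>k, i\<^sub>1, p i\<^sub>1 j, \<dots>, i\<^sub>k, p i\<^sub>k j\<close>, where \<open>i\<^sub>1 < \<dots> < i\<^sub>k\<close> are the machines to
  which \<open>j\<close> can be assigned. Infinite entries are omitted. When every job can be assigned to at most
  two machines, this is never more than a constant factor longer than the full matrix of
  processing times, so a time bound in terms of this length is at least as strong.
\<close>

definition encode_job :: "nat \<Rightarrow> (nat \<Rightarrow> nat \<Rightarrow> enat) \<Rightarrow> nat \<Rightarrow> nat list" where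
  "encode_job m p j =
     (let is = filter (\<lambda>i. p i j < \<infinity>) [0..<m]
      in length is # concat (map (\<lambda>i. [i, the_enat (p i j)]) is))"

definition encode :: "nat \<Rightarrow> nat \<Rightarrow> (nat \<Rightarrow> nat \<Rightarrow> enat) \<Rightarrow> nat list" where
  "encode m n p = m # n # concat (map (encode_job m p) [0..<n])"

text \<open>The number of binary digits; the number \<open>0\<close> is written with one digit.\<close>

definition num_bits :: "nat \<Rightarrow> nat" where
  "num_bits x = max 1 (floorlog 2 x)"

definition input_length :: "nat list \<Rightarrow> nat" where
  "input_length xs = (\<Sum>x\<leftarrow>xs. num_bits x)"


section \<open>Random access machines\<close>

text \<open>
  Algorithms are structured programs for a random access machine with registers and an
  indirectly addressed memory, all holding natural numbers. Every elementary operation and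
  every test takes one unit of time. The only arithmetic operations are addition and (truncated)
  subtraction; as usual for the uniform cost measure, there is no multiplication, so that each
  operation lengthens the largest number held by the machine by at most one bit.
\<close>

datatype instr =
    Const nat nat      \<comment> \<open>\<open>Const r k\<close>: \<open>r := k\<close>\<close>
  | Move nat nat       \<comment> \<open>\<open>Move r a\<close>: \<open>r := a\<close>\<close>
  | Add nat nat nat    \<comment> \<open>\<open>Add r a b\<close>: \<open>r := a + b\<close>\<close>
  | Sub nat nat nat    \<comment> \<open>\<open>Sub r a b\<close>: \<open>r := a - b\<close>\<close>
  | Load nat nat       \<comment> \<open>\<open>Load r a\<close>: \<open>r := memory[a]\<close>\<close>
  | Store nat nat      \<comment> \<open>\<open>Store a b\<close>: \<open>memory[a] := b\<close>\<close>

datatype test = Less nat nat | Equal nat nat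

datatype program =
    Skip
  | Instr instr
  | Seq program program
  | If test program program
  | While test program

text \<open>A machine state consists of the registers and the memory.\<close>

type_synonym state = "(nat \<Rightarrow> nat) \<times> (nat \<Rightarrow> nat)"

fun exec_instr :: "instr \<Rightarrow> state \<Rightarrow> state" where
  "exec_instr (Const r k) (R, S) = (R(r := k), S)"
| "exec_instr (Move r a) (R, S) = (R(r := R a), S)"
| "exec_instr (Add r a b) (R, S) = (R(r := R a + R b), S)"
| "exec_instr (Sub r a b) (R, S) = (R(r := R a - R b), S)"
| "exec_instr (Load r a) (R, S) = (R(r := S (R a)), S)"
| "exec_instr (Store a b) (R, S) = (R, S(R a := R b))"

fun holds :: "test \<Rightarrow> state \<Rightarrow> bool" where
  "holds (Less a b) (R, S) \<longleftrightarrow> R a < R b"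
| "holds (Equal a b) (R, S) \<longleftrightarrow> R a = R b"

text \<open>\<open>runs c s t s'\<close>: program \<open>c\<close> started in state \<open>s\<close> halts in state \<open>s'\<close> after exactly \<open>t\<close> steps.\<close>

inductive runs :: "program \<Rightarrow> state \<Rightarrow> nat \<Rightarrow> state \<Rightarrow> bool" where
  Skip: "runs Skip s 0 s"
| Instr: "runs (Instr c) s 1 (exec_instr c s)"
| Seq: "runs c s t s' \<Longrightarrow> runs d s' u s'' \<Longrightarrow> runs (Seq c d) s (t + u) s''"
| IfTrue: "holds b s \<Longrightarrow> runs c s t s' \<Longrightarrow> runs (If b c d) s (1 + t) s'"
| IfFalse: "\<not> holds b s \<Longrightarrow> runs d s t s' \<Longrightarrow> runs (If b c d) s (1 + t) s'"
| WhileFalse: "\<not> holds b s \<Longrightarrow> runs (While b c) s 1 s"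
| WhileTrue: "holds b s \<Longrightarrow> runs c s t s' \<Longrightarrow> runs (While b c) s' u s'' \<Longrightarrow>
    runs (While b c) s (1 + t + u) s''"

inductive_cases runs_SkipE: "runs Skip s t s'"
inductive_cases runs_InstrE: "runs (Instr c) s t s'"
inductive_cases runs_SeqE: "runs (Seq c d) s t s'"
inductive_cases runs_IfE: "runs (If b c d) s t s'"
inductive_cases runs_WhileE: "runs (While b c) s t s'"

lemma runs_deterministic:
  "runs c s t s' \<Longrightarrow> runs c s u s'' \<Longrightarrow> t = u \<and> s' = s''"
proof (induction arbitrary: u s'' rule: runs.induct)
  case (Seq c s t s' d v w)
  from Seq.prems obtain t1 x t2 where "runs c s t1 x" "runs d x t2 s''" "u = t1 + t2"
    by (rule runs_SeqE) blast
  with Seq.IH show ?case by blast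
next
  case (IfTrue b s c t s' d)
  from IfTrue.prems IfTrue.hyps obtain t1 where "runs c s t1 s''" "u = 1 + t1"
    by (elim runs_IfE) auto
  with IfTrue.IH show ?case by blast
next
  case (IfFalse b s d t s' c)
  from IfFalse.prems IfFalse.hyps obtain t1 where "runs d s t1 s''" "u = 1 + t1"
    by (elim runs_IfE) auto
  with IfFalse.IH show ?case by blast
next
  case (WhileTrue b s c t s' v w)
  from WhileTrue.prems obtain t1 x t2
    where "runs c s t1 x" "runs (While b c) x t2 s''" "u = 1 + t1 + t2"
    by (rule runs_WhileE) (use WhileTrue.hyps in simp_all)
  with WhileTrue.IH show ?case by blast
next
  case (WhileFalse b s c)
  from WhileFalse.prems show ?case
    by (rule runs_WhileE) (use WhileFalse.hyps in simp_all)
qed (auto elim: runs_SkipE runs_InstrE)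

text \<open>
  Initially the memory holds the input from address \<open>0\<close> on; all else is zero. On termination,
  memory cell \<open>j\<close> holds the machine to which job \<open>j\<close> is assigned.
\<close>

definition initial_state :: "nat list \<Rightarrow> state" where
  "initial_state xs = (\<lambda>_. 0, \<lambda>a. if a < length xs then xs ! a else 0)"

definition output_assignment :: "nat \<Rightarrow> state \<Rightarrow> nat \<Rightarrow> nat" where
  "output_assignment n s = restrict (snd s) {..<n}"

end

theory Submission
  imports Defs
begin

text \<open>
  Let the potential \<open>G v\<close> of a machine \<open>v\<close> be its load from the jobs already assigned plus the total
  weight it would have if it also received every undecided job it can process; initially only the
  jobs with one eligible machine are assigned. Repeatedly pick an undecided job \<open>j\<close> and a machine
  \<open>v\<close> minimizing \<open>G v - w v j\<close>, and assign \<open>j\<close> to \<open>v\<close>.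

  Fix a solution of value \<open>T\<close>. As long as the minimum has always been below \<open>T\<close>, machine \<open>v\<close> cannot
  reach \<open>T\<close> without \<open>j\<close>, so the choice agrees with the solution. Once it is at least \<open>T\<close>, every
  machine can afford to lose one job, and since a job has at most two machines, each step hurts only one
  machine. If that machine cannot afford a second loss, it is the one that attains the minimum in
  the next step and receives its largest undecided job, which compensates the earlier loss. Hence all
  potentials stay at least \<open>T\<close>. In the end \<open>G v\<close> is twice the load of \<open>v\<close>. No value of \<open>T\<close> is needed to
  run the algorithm, and \<open>n\<close> rounds of linear scans take quadratic time.
\<close>

section \<open>The greedy algorithm\<close>

locale balancing =
  fixes m n :: nat and p :: "nat \<Rightarrow> nat \<Rightarrow> enat"
  assumes balancing: "maxmin_balancing m n p"
begin

abbreviation E :: "nat \<Rightarrow> nat set" where "E \<equiv> eligible m p"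

definition w :: "nat \<Rightarrow> nat \<Rightarrow> nat" where "w i j = the_enat (p i j)"

definition singleton_job :: "nat \<Rightarrow> bool" where "singleton_job j \<longleftrightarrow> card (E j) = 1"

text \<open>An undecided job counts once for each of its machines. Deciding it moves the chosen
  machine from one copy of the weight to two and the other from one to none, so the final potential
  is twice the load.\<close>

definition potential_term :: "(nat \<Rightarrow> nat option) \<Rightarrow> nat \<Rightarrow> nat \<Rightarrow> nat" where
  "potential_term d i j =
     (case d j of None \<Rightarrow> if i \<in> E j then w i j else 0 | Some v \<Rightarrow> if v = i then 2 * w i j else 0)"

definition partial_potential :: "nat \<Rightarrow> (nat \<Rightarrow> nat option) \<Rightarrow> nat \<Rightarrow> nat" where
  "partial_potential k d i = (\<Sum>j<k. potential_term d i j)"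

abbreviation potential :: "(nat \<Rightarrow> nat option) \<Rightarrow> nat \<Rightarrow> nat" where
  "potential \<equiv> partial_potential n"

definition nat_load :: "(nat \<Rightarrow> nat) \<Rightarrow> nat \<Rightarrow> nat" where
  "nat_load \<sigma> i = (\<Sum>j<n. if \<sigma> j = i then w i j else 0)"

lemma finite_E [simp]: "finite (E j)"
  by (simp add: eligible_def)

lemma E_less: "i \<in> E j \<Longrightarrow> i < m"
  by (simp add: eligible_def)

lemma E_nonempty: "j < n \<Longrightarrow> E j \<noteq> {}"
  using balancing by (simp add: maxmin_balancing_def maxmin_allocation_def)

lemma card_E: "j < n \<Longrightarrow> card (E j) \<le> 2"
  using balancing by (simp add: maxmin_balancing_def)

lemma assignments_E: "\<sigma> \<in> assignments m n p \<Longrightarrow> j < n \<Longrightarrow> \<sigma> j \<in> E j"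
  by (auto simp: assignments_def)

lemma load_eq:
  assumes "\<sigma> \<in> assignments m n p"
  shows "load n p \<sigma> i = enat (nat_load \<sigma> i)"
proof -
  have fin: "p i j = enat (w i j)" if "j < n" "\<sigma> j = i" for j
    using assignments_E[OF assms, of j] that by (auto simp: w_def eligible_def)
  have "load n p \<sigma> i = (\<Sum>j | j < n \<and> \<sigma> j = i. enat (w i j))"
    unfolding load_def by (intro sum.cong) (auto simp: fin)
  also have "\<dots> = enat (\<Sum>j | j < n \<and> \<sigma> j = i. w i j)"
    by (simp flip: of_nat_eq_enat)
  also have "(\<Sum>j | j < n \<and> \<sigma> j = i. w i j) = nat_load \<sigma> i"
    unfolding nat_load_def by (rule sum.mono_neutral_cong_left) auto
  finally show ?thesis .
qed

lemma potential_split: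
  assumes "j < n"
  shows "potential d i = potential_term d i j + (\<Sum>k\<in>{..<n} - {j}. potential_term d i k)"
  unfolding partial_potential_def using assms by (intro sum.remove) auto

text \<open>Written with sums on both sides, because subtraction on natural numbers is
  truncated.\<close>

lemma potential_update:
  assumes "j < n"
  shows "potential (d(j \<mapsto> v)) i + potential_term d i j
    = potential d i + (if v = i then 2 * w i j else 0)"
proof -
  have "(\<Sum>k\<in>{..<n} - {j}. potential_term (d(j \<mapsto> v)) i k) = (\<Sum>k\<in>{..<n} - {j}. potential_term d i k)"
    by (intro sum.cong) (auto simp: potential_term_def)
  then show ?thesis
    using potential_split[OF assms, of d i] potential_split[OF assms, of "d(j \<mapsto> v)" i]
    by (simp add: potential_term_def)
qed

lemma potential_chosen:
  assumes "j < n" "d j = None" "v \<in> E j"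
  shows "potential (d(j \<mapsto> v)) v = potential d v + w v j"
  using potential_update[OF assms(1), of d v v] assms by (simp add: potential_term_def)

lemma potential_other:
  assumes "j < n" "d j = None" "u \<in> E j" "u \<noteq> v"
  shows "potential (d(j \<mapsto> v)) u + w u j = potential d u"
  using potential_update[OF assms(1), of d v u] assms by (simp add: potential_term_def)

lemma potential_unaffected:
  assumes "j < n" "d j = None" "i \<notin> E j" "i \<noteq> v"
  shows "potential (d(j \<mapsto> v)) i = potential d i"
  using potential_update[OF assms(1), of d v i] assms by (simp add: potential_term_def)

lemma weight_le_potential:
  assumes "j < n" "d j = None" "v \<in> E j"
  shows "w v j \<le> potential d v"
  using potential_split[OF assms(1), of d v] assms by (simp add: potential_term_def)

section \<open>The invariant of the greedy steps\<close>

definition agrees :: "(nat \<Rightarrow> nat) \<Rightarrow> (nat \<Rightarrow> nat option) \<Rightarrow> bool" where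
  "agrees \<sigma> d \<longleftrightarrow> (\<forall>j<n. \<forall>v. d j = Some v \<longrightarrow> v = \<sigma> j)"

lemma nat_load_le_potential:
  assumes "\<sigma> \<in> assignments m n p" "agrees \<sigma> d"
  shows "nat_load \<sigma> i \<le> potential d i"
  unfolding nat_load_def partial_potential_def
  using assms by (intro sum_mono)
    (auto simp: agrees_def potential_term_def split: option.splits dest: assignments_E)

text \<open>If \<open>\<sigma>\<close> puts the undecided job \<open>j\<close> elsewhere, the
  potential of \<open>i\<close> counts \<open>w i j\<close> on top of its load. Contrapositively, a
  machine whose potential without \<open>j\<close> is below its load must receive \<open>j\<close>
  in \<open>\<sigma>\<close>.\<close>

lemma nat_load_le_potential_minus:
  assumes "\<sigma> \<in> assignments m n p" "agrees \<sigma> d" "j < n" "d j = None" "i \<in> E j" "\<sigma> j \<noteq> i"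
  shows "nat_load \<sigma> i + w i j \<le> potential d i"
proof -
  have "nat_load \<sigma> i = (\<Sum>k\<in>{..<n} - {j}. if \<sigma> k = i then w i k else 0)"
    unfolding nat_load_def using assms(3,6) by (subst sum.remove[of _ j]) auto
  also have "\<dots> \<le> (\<Sum>k\<in>{..<n} - {j}. potential_term d i k)"
    using assms(1,2) by (intro sum_mono)
      (auto simp: agrees_def potential_term_def split: option.splits dest: assignments_E)
  finally show ?thesis
    using potential_split[OF assms(3), of d i] assms(4,5) by (simp add: potential_term_def)
qed

text \<open>
  As long as forced choices are made, the decisions agree with the reference assignment \<open>\<sigma>\<close>.
  Afterwards there is at most one machine \<open>h\<close> that cannot afford to lose another job.
\<close>

definition greedy_inv :: "nat \<Rightarrow> (nat \<Rightarrow> nat) \<Rightarrow> (nat \<Rightarrow> nat option) \<Rightarrow> bool" where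
  "greedy_inv T \<sigma> d \<longleftrightarrow>
     (\<forall>j<n. \<forall>v. d j = Some v \<longrightarrow> v \<in> E j) \<and> (\<forall>i<m. T \<le> potential d i) \<and>
     (agrees \<sigma> d \<or>
      (\<exists>h. \<forall>j<n. d j = None \<longrightarrow> (\<forall>v \<in> E j - {h}. T + w v j \<le> potential d v)))"

text \<open>Either the choice is forced and agreement with \<open>\<sigma>\<close> persists, or the
  slack clause is re-established with the other machine of \<open>j\<close> as the new
  exception.\<close>

lemma greedy_inv_step:
  assumes inv: "greedy_inv T \<sigma> d" and \<sigma>: "\<sigma> \<in> assignments m n p" "\<forall>i<m. T \<le> nat_load \<sigma> i"
    and j: "j < n" "d j = None" and v: "v \<in> E j"
    and min: "\<And>j' v'. j' < n \<Longrightarrow> d j' = None \<Longrightarrow> v' \<in> E j' \<Longrightarrow>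
      potential d v - w v j \<le> potential d v' - w v' j'"
  shows "greedy_inv T \<sigma> (d(j \<mapsto> v))"
proof -
  let ?d = "d(j \<mapsto> v)"
  have dom: "\<forall>k<n. \<forall>u. ?d k = Some u \<longrightarrow> u \<in> E k"
    using inv v by (auto simp: greedy_inv_def)
  have T: "T \<le> potential d i" if "i < m" for i
    using inv that by (simp add: greedy_inv_def)
  show ?thesis
  proof (cases "agrees \<sigma> d \<and> potential d v < T + w v j")
    case True
    \<comment> \<open>Without \<open>j\<close>, machine \<open>v\<close> would fall below
      \<open>T\<close>, whereas \<open>\<sigma>\<close> gives it at least \<open>T\<close>; hence
      \<open>\<sigma>\<close> puts \<open>j\<close> on \<open>v\<close>.\<close>
    have "T \<le> nat_load \<sigma> v"
      using \<sigma>(2) E_less[OF v] by blast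
    with True have "\<sigma> j = v"
      using nat_load_le_potential_minus[of \<sigma> d j v] \<sigma>(1) j v by linarith
    with True have ag: "agrees \<sigma> ?d"
      by (auto simp: agrees_def)
    have "T \<le> potential ?d i" if "i < m" for i
      using nat_load_le_potential[OF \<sigma>(1) ag, of i] \<sigma>(2) that by (blast intro: le_trans)
    with dom ag show ?thesis
      by (simp add: greedy_inv_def)
  next
    case not_forced: False
    \<comment> \<open>At most one machine \<open>h\<close> lacks slack. If \<open>v\<close> lacks it
      for \<open>j\<close>, then \<open>agrees \<sigma> d\<close> is false, the invariant supplies
      \<open>h\<close>, and \<open>v = h\<close>. Otherwise minimality of the choice gives slack to
      every undecided pair.\<close>
    have "\<exists>h. (\<forall>k<n. d k = None \<longrightarrow> (\<forall>u \<in> E k - {h}. T + w u k \<le> potential d u)) \<and>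
        (v = h \<or> (\<forall>k<n. d k = None \<longrightarrow> (\<forall>u \<in> E k. T + w u k \<le> potential d u)))"
    proof (cases "potential d v < T + w v j")
      case True
      with not_forced inv obtain h
        where h: "\<forall>k<n. d k = None \<longrightarrow> (\<forall>u \<in> E k - {h}. T + w u k \<le> potential d u)"
        by (auto simp: greedy_inv_def)
      have "v = h"
      proof (rule ccontr)
        assume "v \<noteq> h"
        with h j v have "T + w v j \<le> potential d v" by simp
        with True show False by simp
      qed
      with h show ?thesis by blast
    next
      case False
      have "T + w u k \<le> potential d u" if "k < n" "d k = None" "u \<in> E k" for k u
        using min[OF that] False weight_le_potential[of k d u] that by linarith
      then show ?thesis by blast
    qed
    then obtain h
      where h: "\<And>k u. k < n \<Longrightarrow> d k = None \<Longrightarrow> u \<in> E k \<Longrightarrow> u \<noteq> h \<Longrightarrow> T + w u k \<le> potential d u"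
        and vh: "v = h \<or> (\<forall>k<n. d k = None \<longrightarrow> (\<forall>u \<in> E k. T + w u k \<le> potential d u))"
      by blast
    \<comment> \<open>Since a job has at most two machines, only one machine besides
      \<open>v\<close> can be hurt; it is the exception in the new invariant.\<close>
    obtain u where u: "E j \<subseteq> {v, u}"
    proof -
      have "card (E j - {v}) \<le> 1"
        using card_E[OF j(1)] v by (simp add: card_Diff_singleton)
      then have "\<forall>x\<in>E j - {v}. \<forall>y\<in>E j - {v}. x = y"
        using card_le_Suc0_iff_eq[of "E j - {v}"] by simp
      then have "\<exists>u. E j - {v} \<subseteq> {u}" by blast
      then show thesis using that by blast
    qed
    have "T \<le> potential ?d i" if "i < m" for i
    proof -
      consider "i = v" | "i \<in> E j" "i \<noteq> v" | "i \<notin> E j" "i \<noteq> v" by blast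
      then show ?thesis
      proof cases
        case 1
        with T[OF that] show ?thesis by (simp add: potential_chosen[of j d v, OF j v])
      next
        case 2
        then have "T + w i j \<le> potential d i"
          using h[OF j] vh j by blast
        with potential_other[of j d i v, OF j 2] show ?thesis by linarith
      next
        case 3
        with T[OF that] show ?thesis by (simp add: potential_unaffected[of j d i v, OF j])
      qed
    qed
    moreover have "T + w x k \<le> potential ?d x"
      if k: "k < n" "?d k = None" and x: "x \<in> E k" "x \<noteq> u" for k x
    proof -
      have k': "d k = None"
        using k by (auto split: if_splits)
      show ?thesis
      proof (cases "x = v")
        case True
        \<comment> \<open>Comparing \<open>(j, v)\<close> with \<open>(k, v)\<close> shows that
          \<open>j\<close> is a heaviest undecided job of \<open>v\<close>, so the gain from
          \<open>j\<close> covers a later loss of \<open>k\<close>. The bounds by the potential make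
          the truncated differences exact.\<close>
        have "w x k \<le> potential d x"
          using weight_le_potential[of k d x] k(1) k' x(1) by simp
        then have "w v k \<le> w v j"
          using min[of k x] k(1) k' x(1) True weight_le_potential[of j d v, OF j v] by simp
        with True T[OF E_less[OF v]] show ?thesis by (simp add: potential_chosen[of j d v, OF j v])
      next
        case False
        with u x have "x \<notin> E j" by blast
        moreover have "T + w x k \<le> potential d x"
          using h[of k x] vh False k k' x by blast
        ultimately show ?thesis
          using False by (simp add: potential_unaffected[of j d x v, OF j])
      qed
    qed
    ultimately show ?thesis
      using dom unfolding greedy_inv_def by blast
  qed
qed

section \<open>Initial decisions and the approximation ratio\<close>

definition initial_decision :: "nat \<Rightarrow> nat option" where
  "initial_decision j = (if singleton_job j then Some (the_elem (E j)) else None)"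

lemma initial_decision_E: "initial_decision j = Some v \<Longrightarrow> E j = {v}"
  by (auto simp: initial_decision_def singleton_job_def card_1_singleton_iff split: if_splits)

text \<open>A job with a single eligible machine is there in every assignment, so the initial
  decisions agree with \<open>\<sigma>\<close>.\<close>

lemma greedy_inv_initial:
  assumes "\<sigma> \<in> assignments m n p" "\<forall>i<m. T \<le> nat_load \<sigma> i"
  shows "greedy_inv T \<sigma> initial_decision"
proof -
  have ag: "agrees \<sigma> initial_decision"
    using assignments_E[OF assms(1)] initial_decision_E by (fastforce simp: agrees_def)
  moreover have "T \<le> potential initial_decision i" if "i < m" for i
    using nat_load_le_potential[OF assms(1) ag, of i] assms(2) that by (blast intro: le_trans)
  ultimately show ?thesis
    using initial_decision_E by (auto simp: greedy_inv_def)
qed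

lemma potential_final:
  assumes "\<And>j. j < n \<Longrightarrow> d j = Some (\<tau> j)"
  shows "potential d i = 2 * nat_load \<tau> i"
  unfolding partial_potential_def nat_load_def sum_distrib_left
  using assms by (intro sum.cong) (auto simp: potential_term_def)

text \<open>Quantifying over all values and reference assignments keeps both out of the program:
  each step preserves the invariant for all of them at once, and an optimal one is picked only at
  the end.\<close>

definition greedy_reachable :: "(nat \<Rightarrow> nat option) \<Rightarrow> bool" where
  "greedy_reachable d \<longleftrightarrow>
     (\<forall>T \<sigma>. \<sigma> \<in> assignments m n p \<longrightarrow> (\<forall>i<m. T \<le> nat_load \<sigma> i) \<longrightarrow> greedy_inv T \<sigma> d)"

text \<open>Take an optimal \<open>\<sigma>\<close> and its minimum load as \<open>T\<close>. The
  invariant bounds all potentials below by \<open>T\<close>, in particular that of the least loaded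
  machine of \<open>\<tau>\<close>, which is twice its load.\<close>

lemma greedy_approximation:
  assumes d: "greedy_reachable d" and \<tau>: "\<tau> \<in> assignments m n p"
    and final: "\<And>j. j < n \<Longrightarrow> d j = Some (\<tau> j)"
  shows "opt m n p \<le> 2 * min_load m n p \<tau>"
proof -
  have "opt m n p \<in> min_load m n p ` assignments m n p"
    unfolding opt_def using \<tau> by (intro Max_in) (auto simp: finite_assignments)
  then obtain \<sigma> where \<sigma>: "\<sigma> \<in> assignments m n p" "opt m n p = min_load m n p \<sigma>"
    by blast
  show ?thesis
  proof (cases "m = 0")
    case True
    \<comment> \<open>Without machines, \<open>min_load\<close> is the same \<open>Min {}\<close>
      for all assignments.\<close>
    with \<sigma>(2) have "opt m n p = min_load m n p \<tau>"
      by (simp add: min_load_def)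
    then show ?thesis by (simp add: mult_2)
  next
    case False
    have "min_load m n p \<rho> \<in> load n p \<rho> ` {..<m}" for \<rho>
      unfolding min_load_def using False by (intro Min_in) auto
    then obtain i k where i: "i < m" "min_load m n p \<tau> = load n p \<tau> i"
      and k: "min_load m n p \<sigma> = load n p \<sigma> k"
      by (metis (no_types, lifting) imageE lessThan_iff)
    have "min_load m n p \<sigma> \<le> load n p \<sigma> l" if "l < m" for l
      unfolding min_load_def using that by (intro Min_le) auto
    then have "greedy_inv (nat_load \<sigma> k) \<sigma> d"
      using d \<sigma>(1) k by (simp add: greedy_reachable_def load_eq)
    then have "nat_load \<sigma> k \<le> 2 * nat_load \<tau> i"
      using i(1) potential_final[of d \<tau>] final by (simp add: greedy_inv_def)
    then have "enat (nat_load \<sigma> k) \<le> 2 * enat (nat_load \<tau> i)"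
      by (metis enat_ord_simps(1) mult_2 plus_enat_simps(1))
    then show ?thesis
      using \<sigma> i k \<tau> by (simp add: load_eq)
  qed
qed

section \<open>The structure of the encoding\<close>

definition block :: "nat \<Rightarrow> nat list" where "block = encode_job m p"

definition pos :: "nat \<Rightarrow> nat" where "pos j = 2 + (\<Sum>l<j. length (block l))"

text \<open>An upper bound for the length of the input: two header cells and at most five per job.
  The potentials are stored from here on, and additions suffice to compute it.\<close>

definition base :: nat where "base = 5 * n + 2"

text \<open>The balancing hypothesis leaves one or two eligible machines, hence blocks of three or
  five cells. Later computations with memory contents use this split.\<close>

lemma block_cases:
  assumes "j < n"
  obtains (single) a where "E j = {a}" "singleton_job j" "block j = [1, a, w a j]"
    | (double) a b where "E j = {a, b}" "a \<noteq> b" "\<not> singleton_job j" "block j = [2, a, w a j, b, w b j]"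
proof -
  define ms where "ms = filter (\<lambda>i. p i j < \<infinity>) [0..<m]"
  have set: "set ms = E j" and dist: "distinct ms"
    by (auto simp: ms_def eligible_def)
  then have len: "length ms = card (E j)"
    using distinct_card[of ms] by simp
  have b: "block j = length ms # concat (map (\<lambda>i. [i, w i j]) ms)"
    by (simp add: block_def encode_job_def ms_def w_def Let_def)
  have "length ms \<noteq> 0" "length ms \<le> 2"
    using len card_E[OF assms] E_nonempty[OF assms] by auto
  then consider "length ms = 1" | "length ms = 2" by linarith
  then show thesis
  proof cases
    case 1
    then obtain a where ms: "ms = [a]" by (auto simp: length_Suc_conv)
    show thesis
    proof (rule single)
      show "E j = {a}" using set unfolding ms by simp
      show "block j = [1, a, w a j]" using b unfolding ms by simp
      show "singleton_job j" using len 1 by (simp add: singleton_job_def)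
    qed
  next
    case 2
    then obtain a b where ms: "ms = [a, b]" by (auto simp: length_Suc_conv numeral_2_eq_2)
    show thesis
    proof (rule double)
      show "E j = {a, b}" using set unfolding ms by simp
      show "a \<noteq> b" using dist unfolding ms by simp
      show "block j = [2, a, w a j, b, w b j]" using b unfolding ms by simp
      show "\<not> singleton_job j" using len 2 by (simp add: singleton_job_def)
    qed
  qed
qed

lemma length_block: "j < n \<Longrightarrow> length (block j) = (if singleton_job j then 3 else 5)"
  by (rule block_cases) auto

lemma pos_0: "pos 0 = 2"
  by (simp add: pos_def)

lemma pos_Suc: "j < n \<Longrightarrow> pos (Suc j) = pos j + (if singleton_job j then 3 else 5)"
  by (simp add: pos_def length_block)

lemma pos_add_length_le: "j < l \<Longrightarrow> pos j + length (block j) \<le> pos l"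
proof (induction l)
  case (Suc l)
  then show ?case by (cases "j = l") (auto simp: pos_def)
qed simp

text \<open>Two header cells and nonempty earlier blocks come first. The output cell of a job
  therefore lies strictly before its block.\<close>

lemma pos_ge: "j \<le> n \<Longrightarrow> j + 2 \<le> pos j"
  by (induction j) (auto simp: pos_0 pos_Suc)

lemma pos_le: "j \<le> n \<Longrightarrow> pos j \<le> 5 * j + 2"
  by (induction j) (auto simp: pos_0 pos_Suc)

lemma block_end_le_base:
  assumes "j < n"
  shows "pos j + length (block j) \<le> base"
  using pos_add_length_le[OF assms] pos_le[of n] by (simp add: base_def)

lemma nth_concat_map_upt:
  "j < k \<Longrightarrow> c < length (f j) \<Longrightarrow> concat (map f [0..<k]) ! ((\<Sum>l<j. length (f l)) + c) = f j ! c"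
proof (induction k)
  case (Suc k)
  have len: "length (concat (map f [0..<k])) = (\<Sum>l<k. length (f l))" for k
    by (induction k) auto
  show ?case
  proof (cases "j = k")
    case True
    with Suc.prems len show ?thesis by (simp add: nth_append)
  next
    case False
    with Suc.prems have "j < k" by simp
    then have "(\<Sum>l<j. length (f l)) + length (f j) \<le> (\<Sum>l<k. length (f l))"
      using sum_mono2[of "{..<k}" "{..<Suc j}" "\<lambda>l. length (f l)"] by auto
    with Suc \<open>j < k\<close> len show ?thesis by (simp add: nth_append)
  qed
qed simp

lemma length_encode: "length (encode m n p) = pos n"
proof -
  have "length (concat (map f [0..<k])) = (\<Sum>l<k. length (f l))" for f :: "nat \<Rightarrow> nat list" and k
    by (induction k) auto
  then show ?thesis
    by (simp add: encode_def pos_def block_def)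
qed

lemma nth_encode:
  assumes "j < n" "c < length (block j)"
  shows "encode m n p ! (pos j + c) = block j ! c"
  using nth_concat_map_upt[of j n c block] assms by (simp add: encode_def pos_def block_def)

text \<open>Every number takes at least one digit and the encoding has at least \<open>n + 2\<close>
  entries; this turns a time bound in \<open>n\<close> into one in the input length.\<close>

lemma input_length_ge: "n + 2 \<le> input_length (encode m n p)"
proof -
  have "length xs \<le> input_length xs" for xs
    by (induction xs) (auto simp: input_length_def num_bits_def)
  from this[of "encode m n p"] pos_ge[of n] show ?thesis
    by (simp add: length_encode)
qed

end


section \<open>Time-bounded total correctness\<close>

definition halts_within :: "program \<Rightarrow> state \<Rightarrow> nat \<Rightarrow> (state \<Rightarrow> bool) \<Rightarrow> bool" where
  "halts_within c s t Q \<longleftrightarrow> (\<exists>u s'. runs c s u s' \<and> u \<le> t \<and> Q s')"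

fun loop_free :: "program \<Rightarrow> bool" where
  "loop_free (Seq c d) \<longleftrightarrow> loop_free c \<and> loop_free d"
| "loop_free (If b c d) \<longleftrightarrow> loop_free c \<and> loop_free d"
| "loop_free (While b c) \<longleftrightarrow> False"
| "loop_free _ \<longleftrightarrow> True"

text \<open>Only meaningful for loop-free programs.\<close>

fun exec :: "program \<Rightarrow> state \<Rightarrow> state" where
  "exec Skip s = s"
| "exec (Instr i) s = exec_instr i s"
| "exec (Seq c d) s = exec d (exec c s)"
| "exec (If b c d) s = (if holds b s then exec c s else exec d s)"
| "exec (While b c) s = s"

fun cost :: "program \<Rightarrow> nat" where
  "cost Skip = 0"
| "cost (Instr i) = 1"
| "cost (Seq c d) = cost c + cost d"
| "cost (If b c d) = 1 + max (cost c) (cost d)"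
| "cost (While b c) = 0"

lemma halts_withinI: "runs c s u s' \<Longrightarrow> u \<le> t \<Longrightarrow> Q s' \<Longrightarrow> halts_within c s t Q"
  unfolding halts_within_def by (intro exI conjI)

lemma halts_withinE:
  assumes "halts_within c s t Q"
  obtains u s' where "runs c s u s'" "u \<le> t" "Q s'"
  using assms unfolding halts_within_def by (elim exE conjE)

lemma halts_within_mono:
  assumes "halts_within c s t P" "t \<le> u" "\<And>s'. P s' \<Longrightarrow> Q s'"
  shows "halts_within c s u Q"
  using assms(1) by (rule halts_withinE) (rule halts_withinI, assumption, use assms(2,3) in simp_all)

lemma halts_within_Seq:
  assumes "halts_within c s t P" "\<And>s'. P s' \<Longrightarrow> halts_within d s' u Q"
  shows "halts_within (Seq c d) s (t + u) Q"
proof -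
  from assms(1) obtain t' s' where c: "runs c s t' s'" "t' \<le> t" "P s'"
    by (rule halts_withinE)
  from assms(2)[OF c(3)] obtain u' s'' where d: "runs d s' u' s''" "u' \<le> u" "Q s''"
    by (rule halts_withinE)
  from runs.Seq[OF c(1) d(1)] show ?thesis
    by (rule halts_withinI) (use c(2) d(2,3) in simp_all)
qed

lemma halts_within_exec: "loop_free c \<Longrightarrow> halts_within c s (cost c) (\<lambda>s'. s' = exec c s)"
proof (induction c arbitrary: s)
  case Skip
  show ?case by (rule halts_withinI[OF runs.Skip]) simp_all
next
  case (Instr i)
  show ?case by (rule halts_withinI[OF runs.Instr]) simp_all
next
  case (Seq c d)
  have "halts_within (Seq c d) s (cost c + cost d) (\<lambda>s'. s' = exec d (exec c s))"
    by (rule halts_within_Seq[where P = "\<lambda>s'. s' = exec c s"]) (use Seq in simp_all)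
  then show ?case by simp
next
  case (If b c d)
  show ?case
  proof (cases "holds b s")
    case True
    from If have "halts_within c s (cost c) (\<lambda>s'. s' = exec c s)" by simp
    then obtain u s' where "runs c s u s'" "u \<le> cost c" "s' = exec c s"
      by (rule halts_withinE)
    with True show ?thesis by (intro halts_withinI[OF runs.IfTrue]) auto
  next
    case False
    from If have "halts_within d s (cost d) (\<lambda>s'. s' = exec d s)" by simp
    then obtain u s' where "runs d s u s'" "u \<le> cost d" "s' = exec d s"
      by (rule halts_withinE)
    with False show ?thesis by (intro halts_withinI[OF runs.IfFalse]) auto
  qed
qed simp

lemma halts_within_loop_free:
  "loop_free c \<Longrightarrow> cost c \<le> t \<Longrightarrow> Q (exec c s) \<Longrightarrow> halts_within c s t Q"
  by (rule halts_within_mono[OF halts_within_exec]) simp_all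

text \<open>Each of the \<open>k\<close> iterations pays for the body and one test, and the failing
  test adds 1. The invariant carries the iteration number; the induction is on the iterations
  left.\<close>

lemma halts_within_While:
  assumes step: "\<And>j s. j < k \<Longrightarrow> I j s \<Longrightarrow> holds b s \<and> halts_within c s t (I (Suc j))"
    and exit: "\<And>s. I k s \<Longrightarrow> \<not> holds b s"
    and init: "I 0 s"
  shows "halts_within (While b c) s (k * (t + 1) + 1) (I k)"
proof -
  have "halts_within (While b c) s (l * (t + 1) + 1) (I k)" if "j + l = k" "I j s" for j l s
    using that
  proof (induction l arbitrary: j s)
    case 0
    then have "\<not> holds b s" using exit[of s] by simp
    then show ?case
      by (rule halts_withinI[OF runs.WhileFalse]) (use 0 in simp_all)
  next
    case (Suc l)
    then have "holds b s" and body: "halts_within c s t (I (Suc j))"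
      using step[of j s] by auto
    from body obtain u s' where u: "runs c s u s'" "u \<le> t" "I (Suc j) s'"
      by (rule halts_withinE)
    from Suc.IH[of "Suc j" s'] Suc.prems(1) u(3)
    have "halts_within (While b c) s' (l * (t + 1) + 1) (I k)" by simp
    then obtain v s'' where v: "runs (While b c) s' v s''" "v \<le> l * (t + 1) + 1" "I k s''"
      by (rule halts_withinE)
    from runs.WhileTrue[OF \<open>holds b s\<close> u(1) v(1)] show ?case
      by (rule halts_withinI) (use u(2) v(2,3) in simp_all)
  qed
  from this[of 0 k s] init show ?thesis by simp
qed


section \<open>The program\<close>

text \<open>
  Registers: 0 holds 0, 1 the number of jobs, 2 the address of the potential of machine 0,
  3 the address of the current block, 4 the current job, 5 the round, 6 to 9 the constants
  1, 2, 3, 5. Registers 10 to 14 hold the current block, 15 and 16 are scratch, and 20 to 25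
  describe the best candidate found in a round: block address (0 if there is none), machine,
  weight, other machine, weight there, and the minimized value.

  The first cell of a block, initially the number of eligible machines, becomes 3 when the job is
  assigned; the second cell then holds the chosen machine.
\<close>

fun seq :: "program list \<Rightarrow> program" where
  "seq [] = Skip"
| "seq (c # cs) = Seq c (seq cs)"

definition prologue :: program where
  "prologue = seq [Instr (Const 6 1), Instr (Load 1 6), Instr (Const 7 2), Instr (Const 8 3),
     Instr (Const 9 5), Instr (Add 2 1 1), Instr (Add 2 2 2), Instr (Add 2 2 1),
     Instr (Add 2 2 7), Instr (Move 3 7)]"

text \<open>The length of a block stays recoverable: the mark 1 is never changed, while 2 and 3 both
  stand for five cells.\<close>

definition next_block :: program where
  "next_block = seq [If (Equal 10 6) (Instr (Add 3 3 8)) (Instr (Add 3 3 9)), Instr (Add 4 4 6)]"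

text \<open>Five cells are fetched whatever the length. For a three-cell block the last two
  registers receive what follows it, so register 10 is tested before they are relied on.\<close>

definition read_block :: program where
  "read_block = seq [Instr (Load 10 3), Instr (Add 15 3 6), Instr (Load 11 15),
     Instr (Add 15 15 6), Instr (Load 12 15), Instr (Add 15 15 6), Instr (Load 13 15),
     Instr (Add 15 15 6), Instr (Load 14 15)]"

definition increase :: "nat \<Rightarrow> nat \<Rightarrow> program" where
  "increase i x = seq [Instr (Add 15 2 i), Instr (Load 16 15), Instr (Add 16 16 x), Instr (Store 15 16)]"

definition decrease :: "nat \<Rightarrow> nat \<Rightarrow> program" where
  "decrease i x = seq [Instr (Add 15 2 i), Instr (Load 16 15), Instr (Sub 16 16 x), Instr (Store 15 16)]"

text \<open>A job with one machine is decided from the start, hence its weight is added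
  twice.\<close>

definition sum_body :: program where
  "sum_body = seq [read_block, increase 11 12,
     If (Equal 10 6) (increase 11 12) (increase 13 14), next_block]"

definition take_candidate :: program where
  "take_candidate = seq [Instr (Move 20 3), Instr (Move 21 11), Instr (Move 22 12),
     Instr (Move 23 13), Instr (Move 24 14), Instr (Move 25 16)]"

definition test_candidate :: program where
  "test_candidate = seq [Instr (Add 15 2 11), Instr (Load 16 15), Instr (Sub 16 16 12),
     If (Equal 20 0) take_candidate (If (Less 16 25) take_candidate Skip)]"

text \<open>With the sides exchanged, \<open>test_candidate\<close> also serves the second machine
  of the job.\<close>

definition swap_sides :: program where
  "swap_sides = seq [Instr (Move 15 11), Instr (Move 11 13), Instr (Move 13 15),
     Instr (Move 15 12), Instr (Move 12 14), Instr (Move 14 15)]"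

definition scan_body :: program where
  "scan_body = seq [read_block,
     If (Equal 10 7) (seq [test_candidate, swap_sides, test_candidate]) Skip, next_block]"

definition rewind :: program where
  "rewind = seq [Instr (Move 20 0), Instr (Move 3 7), Instr (Move 4 0)]"

text \<open>Rounds without a candidate leave the memory unchanged, so the outer loop can simply run
  \<open>n\<close> times.\<close>

definition assign_best :: program where
  "assign_best = seq [If (Equal 20 0) Skip (seq [increase 21 22, decrease 23 24,
     Instr (Store 20 8), Instr (Add 15 20 6), Instr (Store 15 21)]), Instr (Add 5 5 6)]"

definition round_body :: program where
  "round_body = Seq rewind (Seq (While (Less 4 1) scan_body) assign_best)"

definition output_body :: program where
  "output_body = seq [Instr (Load 10 3), Instr (Add 15 3 6), Instr (Load 11 15),
     Instr (Store 4 11), next_block]"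

definition greedy_program :: program where
  "greedy_program =
     Seq prologue (Seq (While (Less 4 1) sum_body) (Seq (While (Less 5 1) round_body)
       (Seq rewind (While (Less 4 1) output_body))))"

lemmas code_defs = prologue_def next_block_def read_block_def increase_def decrease_def sum_body_def
  take_candidate_def test_candidate_def swap_sides_def scan_body_def rewind_def assign_best_def
  output_body_def

text \<open>The uniform bound 50 is generous; the longest body is \<open>scan_body\<close>, with
  cost 41.\<close>

lemma bodies_bounded:
  "loop_free prologue" "cost prologue \<le> 50" "loop_free sum_body" "cost sum_body \<le> 50"
  "loop_free rewind" "cost rewind \<le> 50" "loop_free scan_body" "cost scan_body \<le> 50"
  "loop_free assign_best" "cost assign_best \<le> 50" "loop_free output_body" "cost output_body \<le> 50"
  by (simp_all add: code_defs)


section \<open>Correctness of the program\<close>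

context balancing
begin

definition ready :: "(nat \<Rightarrow> nat) \<Rightarrow> bool" where
  "ready R \<longleftrightarrow> R 0 = 0 \<and> R 1 = n \<and> R 2 = base \<and> R 6 = 1 \<and> R 7 = 2 \<and> R 8 = 3 \<and> R 9 = 5"

definition at_block :: "nat \<Rightarrow> (nat \<Rightarrow> nat) \<Rightarrow> bool" where
  "at_block k R \<longleftrightarrow> R 3 = pos k \<and> R 4 = k"

text \<open>The second cell names the machine of every decided job, which is what the output loop
  reads. The original five cells are asserted only while the job is undecided, as its assignment
  overwrites the first two.\<close>

definition block_ok :: "(nat \<Rightarrow> nat option) \<Rightarrow> (nat \<Rightarrow> nat) \<Rightarrow> nat \<Rightarrow> bool" where
  "block_ok d S j \<longleftrightarrow>
     S (pos j) = (if singleton_job j then 1 else if d j = None then 2 else 3) \<and>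
     (case d j of None \<Rightarrow> \<not> singleton_job j \<and> (\<forall>c<5. S (pos j + c) = block j ! c)
      | Some v \<Rightarrow> S (pos j + 1) = v)"

definition memory_ok :: "(nat \<Rightarrow> nat option) \<Rightarrow> (nat \<Rightarrow> nat) \<Rightarrow> bool" where
  "memory_ok d S \<longleftrightarrow> (\<forall>j<n. block_ok d S j) \<and> (\<forall>i<m. S (base + i) = potential d i)"

lemma block_cell_less_base: "j < n \<Longrightarrow> c < length (block j) \<Longrightarrow> pos j + c < base"
  using block_end_le_base[of j] by linarith

lemma block_cells_disjoint:
  assumes "j \<noteq> l" "c < length (block j)" "c' < length (block l)"
  shows "pos j + c \<noteq> pos l + c'"
proof (cases "j < l")
  case True
  from pos_add_length_le[OF this] assms show ?thesis by linarith
next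
  case False
  then have "l < j" using assms by simp
  from pos_add_length_le[OF this] assms show ?thesis by linarith
qed

section \<open>Computing the initial potentials\<close>

definition sum_inv :: "nat \<Rightarrow> state \<Rightarrow> bool" where
  "sum_inv k = (\<lambda>(R, S). ready R \<and> at_block k R \<and> R 5 = 0 \<and>
     (\<forall>j<n. \<forall>c<length (block j). S (pos j + c) = block j ! c) \<and>
     (\<forall>i. S (base + i) = partial_potential k initial_decision i))"

text \<open>The input ends at \<open>pos n\<close>, which is at most \<open>base\<close>, so the
  cells from \<open>base\<close> on are still zero, matching the potential over no jobs.\<close>

lemma sum_inv_prologue: "sum_inv 0 (exec prologue (initial_state (encode m n p)))"
proof -
  define S where "S = snd (initial_state (encode m n p))"
  have init: "initial_state (encode m n p) = (\<lambda>_. 0, S)"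
    by (simp add: S_def initial_state_def)
  have "pos j + c < length (encode m n p)" if "j < n" "c < length (block j)" for j c
    using pos_add_length_le[of j n] that by (simp add: length_encode)
  then have blocks: "\<forall>j<n. \<forall>c<length (block j). S (pos j + c) = block j ! c"
    by (simp add: S_def initial_state_def nth_encode)
  have "pos n \<le> base"
    using pos_le[of n] by (simp add: base_def)
  then have free: "\<forall>i. S (base + i) = 0"
    by (simp add: S_def initial_state_def length_encode)
  have "S (Suc 0) = n"
    using pos_ge[of n] by (simp add: S_def initial_state_def length_encode) (simp add: encode_def)
  with blocks free show ?thesis
    by (simp add: init prologue_def sum_inv_def ready_def at_block_def pos_0
        partial_potential_def base_def)
qed

lemma partial_potential_Suc:
  "partial_potential (Suc k) d i = partial_potential k d i + potential_term d i k"
  by (simp add: partial_potential_def)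

lemma sum_inv_step:
  assumes k: "k < n" and inv: "sum_inv k (R, S)"
  shows "sum_inv (Suc k) (exec sum_body (R, S))"
proof -
  have R: "R 0 = 0" "R 1 = n" "R 2 = base" "R 6 = 1" "R 7 = 2" "R 8 = 3" "R 9 = 5"
      "R 3 = pos k" "R 4 = k" "R 5 = 0"
    and blocks: "\<And>j c. j < n \<Longrightarrow> c < length (block j) \<Longrightarrow> S (pos j + c) = block j ! c"
    and G: "\<And>i. S (base + i) = partial_potential k initial_decision i"
    using inv by (auto simp: sum_inv_def ready_def at_block_def)
  have ne: "pos j + c \<noteq> base + i" if "j < n" "c < length (block j)" for j c i
    using block_cell_less_base[OF that] by simp
  from k show ?thesis
  proof (cases rule: block_cases)
    case (single a)
    have S: "S (pos k) = 1" "S (Suc (pos k)) = a" "S (Suc (Suc (pos k))) = w a k"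
      using blocks[OF k, of 0] blocks[OF k, of 1] blocks[OF k, of 2] single by simp_all
    have t: "potential_term initial_decision i k = (if i = a then 2 * w a k else 0)" for i
      using single by (auto simp: potential_term_def initial_decision_def)
    show ?thesis
      using R S blocks ne single
      by (simp add: code_defs sum_inv_def ready_def at_block_def partial_potential_Suc t G pos_Suc k)
  next
    case (double a b)
    have S: "S (pos k) = 2" "S (Suc (pos k)) = a" "S (Suc (Suc (pos k))) = w a k"
        "S (Suc (Suc (Suc (pos k)))) = b" "S (Suc (Suc (Suc (Suc (pos k))))) = w b k"
      using blocks[OF k, of 0] blocks[OF k, of 1] blocks[OF k, of 2] blocks[OF k, of 3]
        blocks[OF k, of 4] double by (simp_all add: numeral_eq_Suc)
    have t: "potential_term initial_decision i k =
        (if i = a then w a k else if i = b then w b k else 0)" for i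
      using double by (auto simp: potential_term_def initial_decision_def)
    show ?thesis
      using R S blocks ne double
      by (simp add: code_defs sum_inv_def ready_def at_block_def partial_potential_Suc t G pos_Suc k)
  qed
qed

lemma sum_inv_memory_ok:
  assumes "sum_inv n (R, S)"
  shows "memory_ok initial_decision S"
proof -
  have "block_ok initial_decision S j" if "j < n" for j
  proof -
    have blocks: "S (pos j + c) = block j ! c" if "c < length (block j)" for c
      using assms \<open>j < n\<close> that by (auto simp: sum_inv_def)
    from \<open>j < n\<close> show ?thesis
      by (cases rule: block_cases)
        (use blocks[of 0] blocks[of 1] blocks in \<open>auto simp: block_ok_def initial_decision_def\<close>)
  qed
  with assms show ?thesis by (auto simp: memory_ok_def sum_inv_def)
qed

section \<open>Searching for the best candidate\<close>

definition candidates :: "(nat \<Rightarrow> nat option) \<Rightarrow> nat \<Rightarrow> (nat \<times> nat) set" where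
  "candidates d k = {(j, v). j < k \<and> d j = None \<and> v \<in> E j}"

text \<open>The registers hold a minimizer over the candidates \<open>C\<close> seen so far. The
  empty case is recognizable because a block address is never 0.\<close>

definition best :: "(nat \<Rightarrow> nat option) \<Rightarrow> (nat \<times> nat) set \<Rightarrow> (nat \<Rightarrow> nat) \<Rightarrow> bool" where
  "best d C R \<longleftrightarrow> (C = {} \<and> R 20 = 0) \<or>
     (\<exists>j v u. (j, v) \<in> C \<and> E j = {v, u} \<and> v \<noteq> u \<and> R 20 = pos j \<and> R 21 = v \<and> R 22 = w v j \<and>
       R 23 = u \<and> R 24 = w u j \<and> R 25 = potential d v - w v j \<and>
       (\<forall>(j', v')\<in>C. potential d v - w v j \<le> potential d v' - w v' j'))"

lemma best_cong:
  assumes "best d C R" "\<And>i. 20 \<le> i \<Longrightarrow> R' i = R i"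
  shows "best d C R'"
  using assms by (simp add: best_def)

lemma pos_pos: "pos j \<noteq> 0"
  by (simp add: pos_def)

text \<open>The record is replaced exactly if there is none or the new value is strictly smaller.
  Registers below 15 survive, so the sides can be swapped and tested again.\<close>

lemma exec_test_candidate:
  assumes C: "best d C R" and R: "R 0 = 0" "R 2 = base" "R 3 = pos j" "R 11 = v" "R 12 = w v j"
      "R 13 = u" "R 14 = w u j"
    and E: "E j = {v, u}" "v \<noteq> u" and S: "S (base + v) = potential d v"
  obtains R' where "exec test_candidate (R, S) = (R', S)" "best d (insert (j, v) C) R'"
    "\<And>i. i < 15 \<Longrightarrow> R' i = R i"
proof -
  define x where "x = potential d v - w v j"
  define R0 where "R0 = R(15 := base + v, 16 := x)"
  define R1 where "R1 = R0(20 := pos j, 21 := v, 22 := w v j, 23 := u, 24 := w u j, 25 := x)"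
  define R' where "R' = (if R 20 = 0 \<or> x < R 25 then R1 else R0)"
  have "exec test_candidate (R, S) = (R', S)"
    using R S by (auto simp: code_defs R0_def R1_def R'_def x_def)
  moreover have "best d (insert (j, v) C) R'"
  proof (cases "R 20 = 0 \<or> x < R 25")
    case True
    have "\<forall>(j', v')\<in>C. x \<le> potential d v' - w v' j'"
    proof (cases "C = {}")
      case False
      with C True obtain v1 j1 where "x < potential d v1 - w v1 j1"
        and "\<forall>(j', v')\<in>C. potential d v1 - w v1 j1 \<le> potential d v' - w v' j'"
        by (auto simp: best_def pos_pos)
      then show ?thesis by fastforce
    qed simp
    moreover have "R' = R1"
      using True by (simp add: R'_def)
    ultimately show ?thesis
      unfolding best_def using E
      by (intro disjI2 exI[of _ j] exI[of _ v] exI[of _ u]) (simp add: R1_def x_def)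
  next
    case False
    with C obtain j1 v1 u1 where "(j1, v1) \<in> C" "E j1 = {v1, u1}" "v1 \<noteq> u1" "R 20 = pos j1"
      "R 21 = v1" "R 22 = w v1 j1" "R 23 = u1" "R 24 = w u1 j1" "R 25 = potential d v1 - w v1 j1"
      "\<forall>(j', v')\<in>C. potential d v1 - w v1 j1 \<le> potential d v' - w v' j'"
      by (auto simp: best_def)
    with False show ?thesis
      unfolding best_def
      by (intro disjI2 exI[of _ j1] exI[of _ v1] exI[of _ u1]) (auto simp: R'_def R0_def x_def)
  qed
  moreover have "R' i = R i" if "i < 15" for i
    using that by (auto simp: R'_def R0_def R1_def)
  ultimately show thesis by (rule that)
qed

definition scan_inv :: "(nat \<Rightarrow> nat option) \<Rightarrow> (nat \<Rightarrow> nat) \<Rightarrow> nat \<Rightarrow> nat \<Rightarrow> state \<Rightarrow> bool" where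
  "scan_inv d S r k = (\<lambda>(R, S'). S' = S \<and> ready R \<and> at_block k R \<and> R 5 = r \<and> best d (candidates d k) R)"

lemma exec_next_block:
  assumes "ready R" "at_block k R" "k < n" "R 10 = 1 \<longleftrightarrow> singleton_job k"
  obtains R' where "exec next_block (R, S) = (R', S)" "ready R'" "at_block (Suc k) R'"
    "\<And>i. i \<noteq> 3 \<Longrightarrow> i \<noteq> 4 \<Longrightarrow> R' i = R i"
proof
  let ?R = "R(3 := pos (Suc k), 4 := Suc k)"
  show "exec next_block (R, S) = (?R, S)"
    using assms by (auto simp: next_block_def ready_def at_block_def pos_Suc fun_eq_iff)
  show "ready ?R" "at_block (Suc k) ?R"
    using assms by (auto simp: ready_def at_block_def)
qed simp

text \<open>An undecided job adds two candidates, one per side of its block; a decided one has mark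
  1 or 3 and adds none. Register 10 is tracked because \<open>next_block\<close> reads the mark from
  it.\<close>

lemma scan_inv_step:
  assumes k: "k < n" and mem: "memory_ok d S" and inv: "scan_inv d S r k (R, S')"
  shows "scan_inv d S r (Suc k) (exec scan_body (R, S'))"
proof -
  have [simp]: "S' = S" and ready: "ready R" and at: "at_block k R" and R5: "R 5 = r"
    and bst: "best d (candidates d k) R"
    using inv by (auto simp: scan_inv_def)
  have R: "R 0 = 0" "R 1 = n" "R 2 = base" "R 6 = 1" "R 7 = 2" "R 8 = 3" "R 9 = 5"
      "R 3 = pos k" "R 4 = k"
    using ready at by (auto simp: ready_def at_block_def)
  have ok: "block_ok d S k"
    using mem k by (simp add: memory_ok_def)
  define R1 where "R1 = R(10 := S (pos k), 11 := S (pos k + 1), 12 := S (pos k + 2),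
    13 := S (pos k + 3), 14 := S (pos k + 4), 15 := pos k + 4)"
  have R1: "exec read_block (R, S) = (R1, S)"
    using R by (simp add: read_block_def R1_def fun_eq_iff numeral_eq_Suc)
  have ready1: "ready R1" and at1: "at_block k R1"
    using ready at by (auto simp: R1_def ready_def at_block_def)
  have bst1: "best d (candidates d k) R1"
    using bst by (rule best_cong) (simp add: R1_def)
  have "\<exists>R2. exec (If (Equal 10 7) (seq [test_candidate, swap_sides, test_candidate]) Skip) (R1, S) = (R2, S) \<and>
      ready R2 \<and> at_block k R2 \<and> R2 5 = r \<and> R2 10 = R1 10 \<and> best d (candidates d (Suc k)) R2"
  proof (cases "d k = None")
    case False
    then have "candidates d (Suc k) = candidates d k"
      by (auto simp: candidates_def less_Suc_eq)
    moreover have "R1 10 \<noteq> R1 7"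
      using ok False R by (auto simp: block_ok_def R1_def)
    ultimately show ?thesis
      using ready1 at1 bst1 R5 by (intro exI[of _ R1]) (simp add: R1_def)
  next
    case True
    then have dbl: "\<not> singleton_job k" and cells: "\<And>c. c < 5 \<Longrightarrow> S (pos k + c) = block k ! c"
      using ok by (auto simp: block_ok_def)
    from k dbl obtain a b where ab: "E k = {a, b}" "a \<noteq> b" "block k = [2, a, w a k, b, w b k]"
      by (metis block_cases)
    have S: "S (pos k) = 2" "S (pos k + 1) = a" "S (pos k + 2) = w a k" "S (pos k + 3) = b"
        "S (pos k + 4) = w b k"
      using cells[of 0] cells[of 1] cells[of 2] cells[of 3] cells[of 4] ab by simp_all
    have G: "S (base + a) = potential d a" "S (base + b) = potential d b"
      using mem ab E_less[of a k] E_less[of b k] by (auto simp: memory_ok_def)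
    obtain R2 where R2: "exec test_candidate (R1, S) = (R2, S)"
        "best d (insert (k, a) (candidates d k)) R2" "\<And>i. i < 15 \<Longrightarrow> R2 i = R1 i"
      by (rule exec_test_candidate[OF bst1, of k a b S]) (use R S ab G in \<open>simp_all add: R1_def\<close>)
    define R3 where "R3 = R2(11 := b, 12 := w b k, 13 := a, 14 := w a k, 15 := w a k)"
    have R3: "exec swap_sides (R2, S) = (R3, S)"
      using S by (simp add: swap_sides_def R3_def R2(3) R1_def fun_eq_iff)
    have bst3: "best d (insert (k, a) (candidates d k)) R3"
      using R2(2) by (rule best_cong) (simp add: R3_def)
    obtain R4 where R4: "exec test_candidate (R3, S) = (R4, S)"
        "best d (insert (k, b) (insert (k, a) (candidates d k))) R4" "\<And>i. i < 15 \<Longrightarrow> R4 i = R3 i"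
      by (rule exec_test_candidate[OF bst3, of k b a S])
        (use R S ab G in \<open>auto simp: R3_def R1_def R2(3)\<close>)
    have "candidates d (Suc k) = insert (k, b) (insert (k, a) (candidates d k))"
      using True ab by (auto simp: candidates_def less_Suc_eq)
    then show ?thesis
      using R4 R2(1) R3 R S R5 by (intro exI[of _ R4])
        (simp add: R3_def R2(3) ready_def at_block_def, simp add: R1_def)
  qed
  then obtain R2 where R2: "exec (If (Equal 10 7) (seq [test_candidate, swap_sides, test_candidate]) Skip) (R1, S) = (R2, S)"
      "ready R2" "at_block k R2" "R2 5 = r" "R2 10 = R1 10" "best d (candidates d (Suc k)) R2"
    by blast
  have "R2 10 = 1 \<longleftrightarrow> singleton_job k"
    using R2(5) ok by (simp add: R1_def block_ok_def)
  then obtain R5 where "exec next_block (R2, S) = (R5, S)" "ready R5" "at_block (Suc k) R5"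
    "\<And>i. i \<noteq> 3 \<Longrightarrow> i \<noteq> 4 \<Longrightarrow> R5 i = R2 i"
    using exec_next_block[OF R2(2,3) k] by blast
  moreover from this have "best d (candidates d (Suc k)) R5"
    by (intro best_cong[OF R2(6)]) auto
  ultimately show ?thesis
    using R1 R2(1,4) by (simp add: scan_body_def scan_inv_def del: exec.simps(4))
qed

section \<open>One round of the greedy algorithm\<close>

definition round_inv :: "nat \<Rightarrow> state \<Rightarrow> bool" where
  "round_inv r = (\<lambda>(R, S). ready R \<and> R 5 = r \<and>
     (\<exists>d. greedy_reachable d \<and> memory_ok d S \<and> card {j. j < n \<and> d j = None} \<le> n - r))"

text \<open>The writes affect two cells of one block and two potentials. Blocks are disjoint and lie
  below \<open>base\<close>, so all else is preserved; the subtraction is exact by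
  \<open>potential_other\<close>.\<close>

lemma memory_ok_assign:
  assumes mem: "memory_ok d S" and j: "j < n" "d j = None" and E: "E j = {v, u}" "v \<noteq> u"
  shows "memory_ok (d(j \<mapsto> v)) (S(base + v := S (base + v) + w v j, base + u := S (base + u) - w u j,
    pos j := 3, pos j + 1 := v))"
    (is "memory_ok _ ?S")
proof -
  define S' where "S' = ?S"
  have dbl: "\<not> singleton_job j"
    using mem j by (auto simp: memory_ok_def block_ok_def)
  have len: "c < length (block l)" if "l < n" "c < 3" for c l
    using length_block[OF that(1)] that(2) by auto
  have ne: "pos l + c \<noteq> base + i" if "l < n" "c < length (block l)" for l c i
    using block_cell_less_base[OF that] by simp
  have "block_ok (d(j \<mapsto> v)) S' l" if "l < n" for l
  proof (cases "l = j")
    case True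
    with dbl show ?thesis by (simp add: block_ok_def S'_def)
  next
    case False
    have same: "S' (pos l + c) = S (pos l + c)" if "c < length (block l)" for c
    proof -
      have "pos l + c \<noteq> pos j + c'" if "c' < 3" for c'
        using block_cells_disjoint[OF False \<open>c < length (block l)\<close> len[OF j(1) that]] .
      from this[of 0] this[of 1] show ?thesis
        using ne[OF \<open>l < n\<close> that, of v] ne[OF \<open>l < n\<close> that, of u] by (simp add: S'_def)
    qed
    have "S' (pos l) = S (pos l)" "S' (pos l + 1) = S (pos l + 1)"
      using same[OF len[OF that, of 0]] same[OF len[OF that, of 1]] by simp_all
    moreover have "S' (pos l + c) = S (pos l + c)" if "c < 5" "\<not> singleton_job l" for c
      using same length_block[OF \<open>l < n\<close>] that by simp
    moreover have "block_ok d S l"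
      using mem that by (simp add: memory_ok_def)
    ultimately show ?thesis
      using False unfolding block_ok_def by (cases "d l") simp_all
  qed
  moreover have "S' (base + i) = potential (d(j \<mapsto> v)) i" if "i < m" for i
  proof -
    have "base + i \<noteq> pos j" "base + i \<noteq> pos j + 1"
      using ne[OF j(1) len[OF j(1)], of 0 i] ne[OF j(1) len[OF j(1)], of 1 i] by simp_all
    then have "S' (base + i) =
        (if i = u then S (base + u) - w u j else if i = v then S (base + v) + w v j else S (base + i))"
      by (simp add: S'_def)
    moreover have "S (base + i) = potential d i"
      using mem that by (simp add: memory_ok_def)
    moreover have "potential (d(j \<mapsto> v)) i = potential d i" if "i \<noteq> u" "i \<noteq> v"
      using potential_unaffected[of j d i v] that j E by simp
    ultimately show ?thesis
      using E potential_chosen[of j d v] potential_other[of j d u v] j by auto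
  qed
  ultimately show ?thesis
    unfolding memory_ok_def S'_def by blast
qed

lemma greedy_reachable_step:
  assumes "greedy_reachable d" "(j, v) \<in> candidates d n"
    "\<forall>(j', v')\<in>candidates d n. potential d v - w v j \<le> potential d v' - w v' j'"
  shows "greedy_reachable (d(j \<mapsto> v))"
  unfolding greedy_reachable_def
proof (intro allI impI)
  fix T \<sigma>
  assume "\<sigma> \<in> assignments m n p" "\<forall>i<m. T \<le> nat_load \<sigma> i"
  with assms show "greedy_inv T \<sigma> (d(j \<mapsto> v))"
    by (intro greedy_inv_step) (auto simp: greedy_reachable_def candidates_def)
qed

text \<open>If there is a candidate, one open job gets decided. If there is none, no job is open, as
  every job has an eligible machine. Either way at most \<open>n - Suc r\<close> jobs stay
  open.\<close>

lemma round_inv_assign: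
  assumes scan: "scan_inv d S r n (R, S')" and d: "greedy_reachable d" and mem: "memory_ok d S"
    and open_jobs: "card {j. j < n \<and> d j = None} \<le> n - r"
  shows "round_inv (Suc r) (exec assign_best (R, S'))"
proof -
  have [simp]: "S' = S" and R: "R 0 = 0" "R 1 = n" "R 2 = base" "R 6 = 1" "R 7 = 2" "R 8 = 3"
      "R 9 = 5" "R 5 = r" and best: "best d (candidates d n) R"
    using scan by (auto simp: scan_inv_def ready_def)
  from best show ?thesis
    unfolding best_def
  proof (elim disjE conjE exE)
    assume "candidates d n = {}" "R 20 = 0"
    then have "{j. j < n \<and> d j = None} = {}"
      using E_nonempty by (auto simp: candidates_def)
    then have "card {j. j < n \<and> d j = None} \<le> n - Suc r"
      by (simp only: card.empty le0)
    moreover have "exec assign_best (R, S') = (R(5 := Suc r), S)"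
      using R \<open>R 20 = 0\<close> by (simp add: assign_best_def)
    ultimately show ?thesis
      using d mem R by (auto simp: round_inv_def ready_def)
  next
    fix j v u
    assume jv: "(j, v) \<in> candidates d n" and E: "E j = {v, u}" "v \<noteq> u"
      and R': "R 20 = pos j" "R 21 = v" "R 22 = w v j" "R 23 = u" "R 24 = w u j"
      and min: "\<forall>(j', v')\<in>candidates d n. potential d v - w v j \<le> potential d v' - w v' j'"
    define M where "M = S(base + v := S (base + v) + w v j, base + u := S (base + u) - w u j,
      pos j := 3, pos j + 1 := v)"
    have j: "j < n" "d j = None"
      using jv by (auto simp: candidates_def)
    have "{k. k < n \<and> (d(j \<mapsto> v)) k = None} = {k. k < n \<and> d k = None} - {j}"
      by auto
    then have "card {k. k < n \<and> (d(j \<mapsto> v)) k = None} \<le> n - Suc r"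
      using open_jobs j by (simp add: card_Diff_singleton)
    moreover have "exec assign_best (R, S') = (R(5 := Suc r, 15 := pos j + 1, 16 := S (base + u) - w u j), M)"
      using R R' E pos_pos[of j] by (auto simp: M_def code_defs fun_eq_iff)
    moreover have "memory_ok (d(j \<mapsto> v)) M"
      unfolding M_def by (rule memory_ok_assign[OF mem j E])
    ultimately show ?thesis
      using R greedy_reachable_step[OF d jv min]
      by (auto simp: round_inv_def ready_def)
  qed
qed

lemma round_step:
  assumes "r < n" "round_inv r (R, S)"
  shows "halts_within round_body (R, S) (51 * n + 101) (round_inv (Suc r))"
proof -
  from assms(2) obtain d where d: "greedy_reachable d" "memory_ok d S"
      "card {j. j < n \<and> d j = None} \<le> n - r" and R: "ready R" "R 5 = r"
    by (auto simp: round_inv_def)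
  have rewind: "halts_within rewind (R, S) 50 (scan_inv d S r 0)"
    by (rule halts_within_loop_free)
      (use R in \<open>auto simp: rewind_def scan_inv_def ready_def at_block_def best_def candidates_def pos_0\<close>)
  have scan: "halts_within (While (Less 4 1) scan_body) s (n * (50 + 1) + 1) (scan_inv d S r n)"
    if "scan_inv d S r 0 s" for s
  proof (rule halts_within_While[where I = "scan_inv d S r"])
    fix k s
    assume k: "k < n" and inv: "scan_inv d S r k s"
    have "halts_within scan_body s 50 (scan_inv d S r (Suc k))"
      by (rule halts_within_loop_free)
        (use scan_inv_step[OF k d(2), of r "fst s" "snd s"] inv in \<open>simp_all add: bodies_bounded\<close>)
    moreover have "holds (Less 4 1) s"
      using k inv by (cases s) (auto simp: scan_inv_def ready_def at_block_def)
    ultimately show "holds (Less 4 1) s \<and> halts_within scan_body s 50 (scan_inv d S r (Suc k))"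
      by simp
  qed (use that in \<open>auto simp: scan_inv_def ready_def at_block_def\<close>)
  have assign: "halts_within assign_best s 50 (round_inv (Suc r))" if "scan_inv d S r n s" for s
    by (rule halts_within_loop_free)
      (use that round_inv_assign[of d S r "fst s" "snd s", OF _ d] in \<open>simp_all add: bodies_bounded\<close>)
  have "halts_within round_body (R, S) (50 + ((n * (50 + 1) + 1) + 50)) (round_inv (Suc r))"
    unfolding round_body_def by (rule halts_within_Seq[OF rewind], rule halts_within_Seq, erule scan, erule assign)
  then show ?thesis
    by (rule halts_within_mono) auto
qed

section \<open>Writing the output\<close>

definition output_inv :: "(nat \<Rightarrow> nat) \<Rightarrow> nat \<Rightarrow> state \<Rightarrow> bool" where
  "output_inv \<tau> k = (\<lambda>(R, S). ready R \<and> at_block k R \<and> (\<forall>j<k. S j = \<tau> j) \<and>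
     (\<forall>j. k \<le> j \<and> j < n \<longrightarrow> S (pos j) = (if singleton_job j then 1 else 3) \<and> S (pos j + 1) = \<tau> j))"

lemma output_inv_step:
  assumes k: "k < n" and inv: "output_inv \<tau> k (R, S)"
  shows "output_inv \<tau> (Suc k) (exec output_body (R, S))"
proof -
  have R: "R 0 = 0" "R 1 = n" "R 2 = base" "R 6 = 1" "R 7 = 2" "R 8 = 3" "R 9 = 5"
      "R 3 = pos k" "R 4 = k"
    and written: "\<And>j. j < k \<Longrightarrow> S j = \<tau> j"
    and rest: "\<And>j. k \<le> j \<Longrightarrow> j < n \<Longrightarrow> S (pos j) = (if singleton_job j then 1 else 3)"
      "\<And>j. k \<le> j \<Longrightarrow> j < n \<Longrightarrow> S (Suc (pos j)) = \<tau> j"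
    using inv by (auto simp: output_inv_def ready_def at_block_def)
  \<comment> \<open>Writing cell \<open>k\<close> spares the cells still to be read, since
    \<open>pos j\<close> is at least \<open>j + 2\<close>.\<close>
  have ne: "pos j \<noteq> k" "Suc (pos j) \<noteq> k" if "k \<le> j" "j < n" for j
    using pos_ge[of j] that by auto
  show ?thesis
    using R rest[of k] rest written ne k
    by (auto simp: code_defs output_inv_def ready_def at_block_def pos_Suc less_Suc_eq)
qed

lemma greedy_reachable_initial: "greedy_reachable initial_decision"
  by (simp add: greedy_reachable_def greedy_inv_initial)

lemma round_inv_output:
  assumes "round_inv n (R, S)"
  obtains \<tau> where "\<tau> \<in> assignments m n p" "opt m n p \<le> 2 * min_load m n p \<tau>"
    "output_inv \<tau> 0 (exec rewind (R, S))"
proof -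
  from assms obtain d where d: "greedy_reachable d" "memory_ok d S"
      "card {j. j < n \<and> d j = None} = 0" and R: "ready R"
    by (auto simp: round_inv_def)
  define \<tau> where "\<tau> = restrict (\<lambda>j. the (d j)) {..<n}"
  have final: "d j = Some (\<tau> j)" if "j < n" for j
    using d(3) that by (auto simp: \<tau>_def)
  \<comment> \<open>The value 0 is a trivial lower bound on loads, so any assignment serves to
    extract from the invariant that all decisions are eligible.\<close>
  obtain \<sigma> where "\<sigma> \<in> assignments m n p"
    using assignments_nonempty[of m n p] balancing by (auto simp: maxmin_balancing_def)
  with d(1) have "greedy_inv 0 \<sigma> d"
    by (simp add: greedy_reachable_def)
  then have "\<tau> j \<in> E j" if "j < n" for j
    using final[OF that] that by (simp add: greedy_inv_def)
  then have \<tau>: "\<tau> \<in> assignments m n p"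
    by (auto simp: assignments_def \<tau>_def)
  show thesis
  proof (rule that[OF \<tau> greedy_approximation[OF d(1) \<tau> final]])
    show "output_inv \<tau> 0 (exec rewind (R, S))"
      using R d(2) final
      by (auto simp: rewind_def output_inv_def ready_def at_block_def pos_0 memory_ok_def block_ok_def)
  qed
qed

text \<open>The phases add up to \<open>51 * n^2 + 204 * n + 103\<close>. The bound is phrased with
  \<open>n + 2\<close> to fit \<open>input_length_ge\<close>.\<close>

lemma greedy_program_correct:
  "halts_within greedy_program (initial_state (encode m n p)) (110 * (n + 2)\<^sup>2)
    (\<lambda>s. output_assignment n s \<in> assignments m n p \<and>
      opt m n p \<le> 2 * min_load m n p (output_assignment n s))"
    (is "halts_within _ _ _ ?Q")
proof -
  let ?P = "\<lambda>s. \<exists>\<tau>. \<tau> \<in> assignments m n p \<and> opt m n p \<le> 2 * min_load m n p \<tau> \<and> output_inv \<tau> 0 s"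
  have prologue: "halts_within prologue (initial_state (encode m n p)) 50 (sum_inv 0)"
    by (rule halts_within_loop_free) (simp_all add: sum_inv_prologue bodies_bounded)
  have sum: "halts_within (While (Less 4 1) sum_body) s (n * (50 + 1) + 1) (round_inv 0)"
    if "sum_inv 0 s" for s
  proof (rule halts_within_mono[OF halts_within_While[of n sum_inv]])
    fix k s
    assume k: "k < n" and inv: "sum_inv k s"
    have "halts_within sum_body s 50 (sum_inv (Suc k))"
      by (rule halts_within_loop_free)
        (use sum_inv_step[OF k, of "fst s" "snd s"] inv in \<open>simp_all add: bodies_bounded\<close>)
    moreover have "holds (Less 4 1) s"
      using k inv by (cases s) (auto simp: sum_inv_def ready_def at_block_def)
    ultimately show "holds (Less 4 1) s \<and> halts_within sum_body s 50 (sum_inv (Suc k))"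
      by simp
  next
    fix s assume s: "sum_inv n s"
    moreover obtain R S where [simp]: "s = (R, S)" by fastforce
    moreover have "card {j. j < n \<and> initial_decision j = None} \<le> n"
      using card_mono[of "{..<n}" "{j. j < n \<and> initial_decision j = None}"] by auto
    ultimately show "round_inv 0 s"
      using sum_inv_memory_ok[of R S] greedy_reachable_initial
      by (auto simp: round_inv_def sum_inv_def)
  qed (use that in \<open>auto simp: sum_inv_def ready_def at_block_def\<close>)
  have rounds: "halts_within (While (Less 5 1) round_body) s (n * (51 * n + 101 + 1) + 1) (round_inv n)"
    if "round_inv 0 s" for s
  proof (rule halts_within_While[where I = round_inv])
    fix r s
    assume r: "r < n" and inv: "round_inv r s"
    have "halts_within round_body s (51 * n + 101) (round_inv (Suc r))"
      using round_step[OF r, of "fst s" "snd s"] inv by simp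
    moreover have "holds (Less 5 1) s"
      using r inv by (cases s) (auto simp: round_inv_def ready_def)
    ultimately show "holds (Less 5 1) s \<and> halts_within round_body s (51 * n + 101) (round_inv (Suc r))"
      by simp
  qed (use that in \<open>auto simp: round_inv_def ready_def\<close>)
  have rewind: "halts_within rewind s 50 ?P" if "round_inv n s" for s
  proof (rule halts_within_loop_free)
    obtain R S where "s = (R, S)" by fastforce
    with that show "?P (exec rewind s)"
      using round_inv_output[of R S] by blast
  qed (simp_all add: rewind_def)
  have out: "halts_within (While (Less 4 1) output_body) s (n * (50 + 1) + 1) ?Q" if "?P s" for s
  proof -
    from that obtain \<tau> where \<tau>: "\<tau> \<in> assignments m n p" "opt m n p \<le> 2 * min_load m n p \<tau>"
      "output_inv \<tau> 0 s" by blast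
    show ?thesis
    proof (rule halts_within_mono[OF halts_within_While[of n "output_inv \<tau>"]])
      fix k s
      assume k: "k < n" and inv: "output_inv \<tau> k s"
      have "halts_within output_body s 50 (output_inv \<tau> (Suc k))"
        by (rule halts_within_loop_free)
          (use output_inv_step[OF k, of \<tau> "fst s" "snd s"] inv in \<open>simp_all add: bodies_bounded\<close>)
      moreover have "holds (Less 4 1) s"
        using k inv by (cases s) (auto simp: output_inv_def ready_def at_block_def)
      ultimately show "holds (Less 4 1) s \<and> halts_within output_body s 50 (output_inv \<tau> (Suc k))"
        by simp
    next
      fix s assume "output_inv \<tau> n s"
      then have "restrict (snd s) {..<n} = restrict \<tau> {..<n}"
        by (auto simp: output_inv_def restrict_def fun_eq_iff)
      also have "\<dots> = \<tau>"
        using \<tau>(1) by (auto simp: assignments_def intro: PiE_restrict)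
      finally have "output_assignment n s = \<tau>"
        by (simp add: output_assignment_def)
      with \<tau> show "?Q s" by simp
    qed (use \<tau>(3) in \<open>auto simp: output_inv_def ready_def at_block_def\<close>)
  qed
  have "halts_within greedy_program (initial_state (encode m n p))
      (50 + ((n * (50 + 1) + 1) + ((n * (51 * n + 101 + 1) + 1) + (50 + (n * (50 + 1) + 1))))) ?Q"
    unfolding greedy_program_def
    by (rule halts_within_Seq[OF prologue], rule halts_within_Seq, erule sum,
        rule halts_within_Seq, erule rounds, rule halts_within_Seq, erule rewind, erule out)
  then show ?thesis
    by (rule halts_within_mono) (auto simp: power2_eq_square algebra_simps)
qed

end


theorem theorem12:
  shows "\<exists>(A :: program) (T :: nat \<Rightarrow> nat).
    (\<lambda>N. real (T N)) \<in> O(\<lambda>N. real N ^ 2) \<and>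
    (\<forall>(m :: nat) (n :: nat) (p :: nat \<Rightarrow> nat \<Rightarrow> enat). maxmin_balancing m n p \<longrightarrow>
      (\<exists>t s. runs A (initial_state (encode m n p)) t s \<and>
        t \<le> T (input_length (encode m n p)) \<and>
        output_assignment n s \<in> assignments m n p \<and>
        opt m n p \<le> 2 * min_load m n p (output_assignment n s)))"
proof (intro exI[of _ greedy_program] exI[of _ "\<lambda>N. 110 * N\<^sup>2"] conjI allI impI)
  show "(\<lambda>N. real (110 * N\<^sup>2)) \<in> O(\<lambda>N. real N ^ 2)"
    by (intro bigoI[of _ 110]) (simp add: eventually_at_top_linorder)
next
  fix m n p
  assume "maxmin_balancing m n p"
  then interpret balancing m n p by unfold_locales
  have "110 * (n + 2)\<^sup>2 \<le> 110 * (input_length (encode m n p))\<^sup>2"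
    using input_length_ge by (simp add: power_mono)
  with greedy_program_correct
  show "\<exists>t s. runs greedy_program (initial_state (encode m n p)) t s \<and>
      t \<le> 110 * (input_length (encode m n p))\<^sup>2 \<and>
      output_assignment n s \<in> assignments m n p \<and>
      opt m n p \<le> 2 * min_load m n p (output_assignment n s)"
    by (elim halts_withinE) (blast intro: le_trans)
qed

end
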